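(* Let $T_n(x)=\sum_{k=0}^{n-1}|c_n(k)|x^k$. Then: (i) $T_n(-1)=\varphi(n)$ for every odd $n\ge 1$; (ii) $T_n(-1)=0$ for every $n=4k+2$, $k\ge 0$; (iii) $T_n(-1)=\varphi(n)2^{\omega(n)}$ for every $n=4k$, $k\ge 1$; (iv) $T_n(\eta)=n\prod_{p\mid n}\big(1-\frac{2}{p}\big)$ for every primitive $n$th root of unity $\eta$; moreover, the cyclotomic polynomial $\Phi_n(x)$ divides $T_n(x)$ for every even $n\ge 2$.
   Context: For integers $n\ge 1$ and $k$, the Ramanujan sum $c_n(k)$ is the sum of the $k$th powers of the primitive $n$th roots of unity, i.e. $c_n(k)=\sum_{1\le j\le n,\ \gcd(j,n)=1} e^{2\pi \sqrt{-1}\, jk/n}$. $\varphi$ is Euler's function, $\omega(n)$ the number of distinct prime factors of $n$, and $\Phi_n(x)$ the $n$th cyclotomic polynomial. Products over $p$ are over primes. *)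

theory Defs
  imports
    "HOL-Analysis.Analysis"
    "HOL-Computational_Algebra.Computational_Algebra"
    "HOL-Number_Theory.Totient"
begin

definition ramanujan_sum :: "nat \<Rightarrow> int \<Rightarrow> complex" where
  "ramanujan_sum n k =
     (\<Sum>j\<in>{j\<in>{1..n}. gcd j n = 1}.
        exp (2 * of_real pi * \<i> * of_nat j * of_int k / of_nat n))"

definition abs_ramanujan_poly :: "nat \<Rightarrow> complex poly" where
  "abs_ramanujan_poly n =
     (\<Sum>k<n. Polynomial.monom (of_real (cmod (ramanujan_sum n (int k)))) k)"

definition primitive_root_of_unity :: "nat \<Rightarrow> complex \<Rightarrow> bool" where
  "primitive_root_of_unity n z \<longleftrightarrow>
     n > 0 \<and> z ^ n = 1 \<and> (\<forall>m. 0 < m \<and> m < n \<longrightarrow> z ^ m \<noteq> 1)"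

definition cyclotomic_poly :: "nat \<Rightarrow> complex poly" where
  "cyclotomic_poly n = (\<Prod>z | primitive_root_of_unity n z. [:- z, 1:])"

definition num_prime_factors :: "nat \<Rightarrow> nat" where
  "num_prime_factors n = card (prime_factors n)"

text \<open>Divisibility in \<open>\<int>[x]\<close> of complex polynomials that are required to have integer
  coefficients.\<close>

definition int_poly_dvd :: "complex poly \<Rightarrow> complex poly \<Rightarrow> bool" where
  "int_poly_dvd F P \<longleftrightarrow>
     (\<exists>f p :: int poly. F = map_poly of_int f \<and> P = map_poly of_int p \<and> f dvd p)"

end

theory Submission
  imports Defs
begin

text \<open>
  Write \<open>c\<^sub>n(k)\<close> as the sum of \<open>z\<^sup>k\<close> over the primitive \<open>n\<close>th roots of unity \<open>z\<close>. For coprime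
  \<open>m\<close> and \<open>n\<close>, the map \<open>w \<mapsto> (w\<^sup>n, w\<^sup>m)\<close> sends the primitive \<open>mn\<close>th roots bijectively to pairs of
  primitive \<open>m\<close>th and \<open>n\<close>th roots, so \<open>c\<^sub>m\<^sub>n(in + jm) = c\<^sub>m(i) c\<^sub>n(j)\<close>. By the Chinese remainder
  theorem this gives \<open>T\<^sub>m\<^sub>n(z) = T\<^sub>m(z\<^sup>n) T\<^sub>n(z\<^sup>m)\<close> whenever \<open>z\<close> is an \<open>mn\<close>th root of unity, which
  reduces the values at \<open>1\<close>, at \<open>-1\<close> for even \<open>n\<close>, and at primitive roots to prime powers, where
  \<open>|c\<^sub>n(k)|\<close> is explicit. For odd \<open>n\<close>, \<open>-1\<close> is not an \<open>n\<close>th root of unity, but then the terms \<open>k\<close> and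
  \<open>n - k\<close> of \<open>T\<^sub>n(-1)\<close> cancel. For even \<open>n\<close> the factor at \<open>p = 2\<close> makes \<open>T\<^sub>n\<close> vanish at all roots of
  \<open>\<Phi>\<^sub>n\<close>; since \<open>\<Phi>\<^sub>n\<close> is monic and both polynomials have integer coefficients, the quotient does too.
\<close>

subsection \<open>Primitive roots of unity\<close>

lemma power_power_commute: "((z :: 'a :: monoid_mult) ^ i) ^ j = (z ^ j) ^ i"
  by (simp only: mult.commute flip: power_mult)

lemma power_mod_root_of_unity:
  assumes "(z :: 'a :: monoid_mult) ^ n = 1"
  shows "z ^ (k mod n) = z ^ k"
proof -
  have "z ^ k = (z ^ n) ^ (k div n) * z ^ (k mod n)"
    by (metis mult_div_mod_eq power_add power_mult)
  thus ?thesis using assms by simp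
qed

text \<open>The remainder of \<open>m\<close> modulo \<open>n\<close> is an exponent below
  \<open>n\<close> that also gives 1, so minimality makes it 0. Together with its converse
  \<open>primitive_rootI\<close> this turns questions about orders into questions about
  divisibility.\<close>

lemma primitive_root_pow_eq_1_iff:
  assumes "primitive_root_of_unity n z"
  shows "z ^ m = 1 \<longleftrightarrow> n dvd m"
proof
  have n: "n > 0" "z ^ n = 1" using assms by (auto simp: primitive_root_of_unity_def)
  assume "z ^ m = 1"
  hence eq: "z ^ (m mod n) = 1" unfolding power_mod_root_of_unity[OF n(2)] .
  have less: "m mod n < n" using n(1) by (rule mod_less_divisor)
  have minimal: "\<forall>k. 0 < k \<and> k < n \<longrightarrow> z ^ k \<noteq> 1"
    using assms unfolding primitive_root_of_unity_def by (elim conjE)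
  have "m mod n = 0"
  proof (rule ccontr)
    assume "m mod n \<noteq> 0"
    hence "z ^ (m mod n) \<noteq> 1" using less minimal by (metis gr0I)
    thus False using eq by contradiction
  qed
  thus "n dvd m" by (rule mod_0_imp_dvd)
next
  assume "n dvd m"
  thus "z ^ m = 1" using assms by (auto simp: primitive_root_of_unity_def power_mult elim!: dvdE)
qed

lemma primitive_rootI:
  assumes "n > 0" "\<And>m. z ^ m = 1 \<longleftrightarrow> n dvd m"
  shows "primitive_root_of_unity n z"
  using assms(1) unfolding primitive_root_of_unity_def assms(2) by (simp add: nat_dvd_not_less)

lemma primitive_root_inj:
  assumes "primitive_root_of_unity n z" "primitive_root_of_unity m z"
  shows "n = m"
proof (rule dvd_antisym)
  have "n dvd k \<longleftrightarrow> m dvd k" for k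
    using primitive_root_pow_eq_1_iff[OF assms(1), of k] primitive_root_pow_eq_1_iff[OF assms(2), of k]
    by simp
  from this[of m] this[of n] show "n dvd m" "m dvd n" by simp_all
qed

lemma primitive_root_exists:
  assumes "n > 0" "(z :: complex) ^ n = 1"
  shows "\<exists>d. d dvd n \<and> primitive_root_of_unity d z"
proof -
  define d where "d = (LEAST d. d > 0 \<and> z ^ d = 1)"
  have d: "d > 0 \<and> z ^ d = 1" unfolding d_def by (rule LeastI[of _ n]) (use assms in auto)
  have "primitive_root_of_unity d z"
    using d not_less_Least[of _ "\<lambda>d. d > 0 \<and> z ^ d = 1"]
    unfolding primitive_root_of_unity_def d_def[symmetric] by blast
  thus ?thesis using primitive_root_pow_eq_1_iff assms by blast
qed

lemma roots_of_unity_eq_Union_primitive: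
  assumes "n > 0"
  shows "{z :: complex. z ^ n = 1} = (\<Union>d\<in>{d. d dvd n}. {z. primitive_root_of_unity d z})"
proof safe
  fix z :: complex assume "z ^ n = 1"
  thus "z \<in> (\<Union>d\<in>{d. d dvd n}. {z. primitive_root_of_unity d z})"
    using primitive_root_exists[OF assms, of z] by auto
qed (simp add: primitive_root_pow_eq_1_iff)

lemma finite_primitive_roots: "finite {z. primitive_root_of_unity n z}"
proof (cases "n = 0")
  case False
  thus ?thesis
    by (intro finite_subset[OF _ finite_roots_unity[of n]]) (auto simp: primitive_root_of_unity_def)
qed (auto simp: primitive_root_of_unity_def)

text \<open>Each \<open>n\<close>th root of unity has exactly one order, a divisor of
  \<open>n\<close>. This is the source of the divisor recursions for Ramanujan sums below.\<close>

lemma sum_roots_of_unity_by_order: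
  assumes "n > 0"
  shows "(\<Sum>z | z ^ n = 1. f z) =
    (\<Sum>d | d dvd n. \<Sum>z | primitive_root_of_unity d z. f (z :: complex))"
  unfolding roots_of_unity_eq_Union_primitive[OF assms]
proof (rule sum.UNION_disjoint)
  show "finite {d. d dvd n}" using assms by simp
  show "\<forall>d\<in>{d. d dvd n}. finite {z. primitive_root_of_unity d z}"
    using finite_primitive_roots by blast
  show "\<forall>d\<in>{d. d dvd n}. \<forall>e\<in>{d. d dvd n}. d \<noteq> e \<longrightarrow>
      {z. primitive_root_of_unity d z} \<inter> {z. primitive_root_of_unity e z} = {}"
    using primitive_root_inj by blast
qed

lemma primitive_root_cis:
  assumes "n > 0"
  shows "primitive_root_of_unity n (cis (2 * pi / n))"
  unfolding primitive_root_of_unity_def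
proof (intro conjI allI impI assms)
  show "cis (2 * pi / n) ^ n = 1" using assms by (simp add: Complex.DeMoivre)
  fix m assume m: "0 < m \<and> m < n"
  have "inj_on (\<lambda>k. cis (2 * pi * real k / real n)) {..<n}"
    using Complex.bij_betw_roots_unity[OF assms] by (auto simp: bij_betw_def)
  hence "cis (2 * pi * real m / real n) \<noteq> cis (2 * pi * real 0 / real n)"
    using m by (metis inj_onD lessThan_iff nat_neq_iff order.strict_trans)
  thus "cis (2 * pi / n) ^ m \<noteq> 1" by (simp add: Complex.DeMoivre field_simps)
qed

lemma primitive_root_power_iff:
  assumes "primitive_root_of_unity n w"
  shows "primitive_root_of_unity n (w ^ j) \<longleftrightarrow> coprime j n"
proof
  have n: "n > 0" using assms by (auto simp: primitive_root_of_unity_def)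
  assume "primitive_root_of_unity n (w ^ j)"
  note P = primitive_root_pow_eq_1_iff[OF this, of "n div gcd j n"]
  \<comment> \<open>The exponent \<open>n div gcd j n\<close> already sends \<open>w ^ j\<close> to
    1, so an order of \<open>n\<close> leaves room only for \<open>gcd j n = 1\<close>.\<close>
  have "j * (n div gcd j n) = n * (j div gcd j n)"
    by (metis div_mult_swap gcd_dvd1 gcd_dvd2 mult.commute)
  hence "n dvd j * (n div gcd j n)" by simp
  hence "n dvd n div gcd j n"
    using P by (simp add: primitive_root_pow_eq_1_iff[OF assms] flip: power_mult)
  hence "n \<le> n div gcd j n"
    using n by (intro dvd_imp_le) (auto simp: div_greater_zero_iff gcd_le2_nat)
  hence "\<not> 1 < gcd j n" using n div_less_dividend[of "gcd j n" n] by linarith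
  moreover have "gcd j n > 0" using n by simp
  ultimately have "gcd j n = 1" by linarith
  thus "coprime j n" by (simp add: coprime_iff_gcd_eq_1)
next
  assume "coprime j n"
  hence "n dvd j * m \<longleftrightarrow> n dvd m" for m
    by (simp add: coprime_commute coprime_dvd_mult_right_iff)
  moreover have "n > 0" using assms by (auto simp: primitive_root_of_unity_def)
  ultimately show "primitive_root_of_unity n (w ^ j)"
    by (intro primitive_rootI) (simp_all add: primitive_root_pow_eq_1_iff[OF assms] flip: power_mult)
qed

lemma inj_on_primitive_root_power:
  assumes "primitive_root_of_unity n w"
  shows "inj_on (\<lambda>j. w ^ j) {1..n}"
proof (rule linorder_inj_onI)
  fix i j assume *: "i < j" "i \<in> {1..n}" "j \<in> {1..n}"
  have "w \<noteq> 0" using assms by (auto simp: primitive_root_of_unity_def zero_power)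
  show "w ^ i \<noteq> w ^ j"
  proof
    assume eq: "w ^ i = w ^ j"
    have "w ^ j = w ^ i * w ^ (j - i)" using * by (simp flip: power_add)
    with eq have "w ^ (j - i) = 1" using \<open>w \<noteq> 0\<close> by simp
    hence "n dvd j - i" using primitive_root_pow_eq_1_iff[OF assms] by simp
    hence "n \<le> j - i" using * by (intro dvd_imp_le) auto
    thus False using * by auto
  qed
qed auto

text \<open>The powers are distinct and there are exactly \<open>n\<close> complex
  \<open>n\<close>th roots, so counting gives surjectivity. The range \<open>{1..n}\<close> matches
  the index set of \<open>ramanujan_sum\<close>.\<close>

lemma bij_betw_primitive_root_power:
  assumes "primitive_root_of_unity n w"
  shows "bij_betw (\<lambda>j. w ^ j) {1..n} {z. z ^ n = 1}"
proof -
  have n: "n > 0" "w ^ n = 1" using assms by (auto simp: primitive_root_of_unity_def)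
  have "(\<lambda>j. w ^ j) ` {1..n} = {z. z ^ n = 1}"
  proof (rule card_subset_eq)
    show "(\<lambda>j. w ^ j) ` {1..n} \<subseteq> {z. z ^ n = 1}"
      using n by (auto simp: power_power_commute[of w _ n])
    show "card ((\<lambda>j. w ^ j) ` {1..n}) = card {z :: complex. z ^ n = 1}"
      using card_image[OF inj_on_primitive_root_power[OF assms]] card_roots_unity_eq[OF n(1)] by simp
    show "finite {z :: complex. z ^ n = 1}" using finite_roots_unity[of n] n by simp
  qed
  thus ?thesis using inj_on_primitive_root_power[OF assms] by (simp add: bij_betw_def)
qed

lemma bij_betw_totatives_primitive_roots:
  assumes "primitive_root_of_unity n w"
  shows "bij_betw (\<lambda>j. w ^ j) {j\<in>{1..n}. gcd j n = 1} {z. primitive_root_of_unity n z}"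
proof -
  have "(\<lambda>j. w ^ j) ` {j\<in>{1..n}. gcd j n = 1} = {z. primitive_root_of_unity n z}"
  proof safe
    fix z assume z: "primitive_root_of_unity n z"
    hence "z ^ n = 1" by (auto simp: primitive_root_of_unity_def)
    hence "z \<in> (\<lambda>j. w ^ j) ` {1..n}" 
      using bij_betw_primitive_root_power[OF assms] by (auto simp: bij_betw_def)
    then obtain j where j: "j \<in> {1..n}" "z = w ^ j" by blast
    with z show "z \<in> (\<lambda>j. w ^ j) ` {j\<in>{1..n}. gcd j n = 1}"
      using primitive_root_power_iff[OF assms, of j] by (auto simp: coprime_iff_gcd_eq_1)
  qed (use primitive_root_power_iff[OF assms] in \<open>auto simp: coprime_iff_gcd_eq_1\<close>)
  moreover have "inj_on (\<lambda>j. w ^ j) {j\<in>{1..n}. gcd j n = 1}"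
    by (rule inj_on_subset[OF inj_on_primitive_root_power[OF assms]]) blast
  ultimately show ?thesis by (simp add: bij_betw_def)
qed

lemma card_primitive_roots:
  assumes "n > 0"
  shows "card {z. primitive_root_of_unity n z} = totient n"
proof -
  have "{j\<in>{1..n}. gcd j n = 1} = totatives n"
    by (auto simp: totatives_def coprime_iff_gcd_eq_1)
  thus ?thesis
    using bij_betw_same_card[OF bij_betw_totatives_primitive_roots[OF primitive_root_cis[OF assms]]]
    by (simp add: totient_def)
qed

section \<open>Ramanujan sums as power sums over primitive roots\<close>

lemma ramanujan_sum_eq_sum_primitive_roots:
  assumes "n > 0"
  shows "ramanujan_sum n (int k) = (\<Sum>z | primitive_root_of_unity n z. z ^ k)"
proof -
  have "exp (2 * of_real pi * \<i> * of_nat j * of_int (int k) / of_nat n) = (cis (2 * pi / n) ^ j) ^ k"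
    for j
  proof -
    have "(cis (2 * pi / n) ^ j) ^ k = exp (of_nat (j * k) * (\<i> * complex_of_real (2 * pi / n)))"
      unfolding cis_conv_exp exp_of_nat_mult power_mult ..
    also have "of_nat (j * k) * (\<i> * complex_of_real (2 * pi / n)) =
        2 * of_real pi * \<i> * of_nat j * of_int (int k) / of_nat n"
      by simp
    finally show ?thesis ..
  qed
  thus ?thesis
    unfolding ramanujan_sum_def
    using sum.reindex_bij_betw[OF bij_betw_totatives_primitive_roots[OF primitive_root_cis[OF assms]], of "\<lambda>z. z ^ k"]
    by simp
qed

lemma sum_powers_root_of_unity:
  assumes "(w :: complex) ^ n = 1"
  shows "(\<Sum>i<n. w ^ i) = (if w = 1 then of_nat n else 0)"
  using assms geometric_sum[of w n] by auto

lemma sum_roots_of_unity_power: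
  assumes "n > 0"
  shows "(\<Sum>z | z ^ n = 1. (z :: complex) ^ k) = (if n dvd k then of_nat n else 0)"
proof -
  define w where "w = cis (2 * pi / n)"
  have w: "primitive_root_of_unity n w" unfolding w_def using assms by (rule primitive_root_cis)
  hence wn: "(w ^ k) ^ n = 1"
    by (simp add: primitive_root_of_unity_def power_power_commute[of w _ n])
  have "(\<Sum>z | z ^ n = 1. (z :: complex) ^ k) = (\<Sum>j\<in>{1..n}. (w ^ j) ^ k)"
    using sum.reindex_bij_betw[OF bij_betw_primitive_root_power[OF w], of "\<lambda>z. z ^ k"] by simp
  also have "\<dots> = (\<Sum>j\<in>{1..n}. (w ^ k) ^ j)" by (simp add: power_power_commute[of w _ k])
  \<comment> \<open>Shifting the index costs a factor \<open>w ^ k\<close>, which is harmless: it is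
    1 if \<open>n dvd k\<close>, and otherwise it multiplies 0.\<close>
  also have "\<dots> = (\<Sum>j<n. (w ^ k) ^ Suc j)"
    by (rule sum.reindex_bij_witness[of _ Suc "\<lambda>i. i - 1"]) auto
  also have "\<dots> = w ^ k * (\<Sum>j<n. (w ^ k) ^ j)" by (simp add: sum_distrib_left)
  also have "\<dots> = (if n dvd k then of_nat n else 0)"
    unfolding sum_powers_root_of_unity[OF wn] 
    using primitive_root_pow_eq_1_iff[OF w] by auto
  finally show ?thesis .
qed

subsection \<open>Multiplicativity\<close>

lemma poly_abs_ramanujan_poly:
  "poly (abs_ramanujan_poly n) z = (\<Sum>k<n. of_real (cmod (ramanujan_sum n (int k))) * z ^ k)"
  by (simp add: abs_ramanujan_poly_def poly_sum poly_monom)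

text \<open>The order of \<open>x / y\<close> divides both \<open>m\<close> and \<open>n\<close>,
  hence is 1.\<close>

lemma eq_if_coprime_powers_eq:
  fixes x y :: complex
  assumes "coprime m n" "x ^ m = y ^ m" "x ^ n = y ^ n" "x \<noteq> 0" "y \<noteq> 0" "m > 0"
  shows "x = y"
proof -
  have 1: "(x / y) ^ m = 1" "(x / y) ^ n = 1" using assms by (simp_all add: power_divide)
  obtain d where d: "d dvd m" "primitive_root_of_unity d (x / y)"
    using primitive_root_exists[OF \<open>m > 0\<close> 1(1)] by blast
  have "d dvd n" using primitive_root_pow_eq_1_iff[OF d(2)] 1(2) by simp
  hence "d = 1" using d(1) \<open>coprime m n\<close> by (metis coprime_common_divisor_nat)
  hence "x / y = 1" using d(2) by (simp add: primitive_root_of_unity_def)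
  thus ?thesis using assms by simp
qed

lemma primitive_root_power_cofactor:
  assumes "primitive_root_of_unity (m * n) w"
  shows "primitive_root_of_unity m (w ^ n)"
proof (rule primitive_rootI)
  have *: "m * n > 0" using assms by (simp add: primitive_root_of_unity_def)
  thus "m > 0" by simp
  fix k show "(w ^ n) ^ k = 1 \<longleftrightarrow> m dvd k"
    using primitive_root_pow_eq_1_iff[OF assms, of "n * k"] * by (simp add: power_mult mult.commute[of m n])
qed

lemma bij_betw_primitive_roots_coprime:
  assumes "coprime m n" "m > 0" "n > 0"
  shows "bij_betw (\<lambda>w. (w ^ n, w ^ m)) {w. primitive_root_of_unity (m * n) w}
           ({u. primitive_root_of_unity m u} \<times> {v. primitive_root_of_unity n v})"
proof -
  let ?f = "\<lambda>w :: complex. (w ^ n, w ^ m)" and ?P = "\<lambda>n. {z. primitive_root_of_unity n z}"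
  have nz: "w \<noteq> 0" if "primitive_root_of_unity (m * n) w" for w
    using that by (auto simp: primitive_root_of_unity_def zero_power)
  have inj: "inj_on ?f (?P (m * n))"
  proof (rule inj_onI)
    fix x y assume "x \<in> ?P (m * n)" "y \<in> ?P (m * n)" "?f x = ?f y"
    thus "x = y" using eq_if_coprime_powers_eq[OF assms(1), of x y] nz assms by simp
  qed
  have "?f ` ?P (m * n) = ?P m \<times> ?P n"
  proof (rule card_subset_eq)
    show "finite (?P m \<times> ?P n)" by (simp add: finite_primitive_roots)
    show "?f ` ?P (m * n) \<subseteq> ?P m \<times> ?P n"
      using primitive_root_power_cofactor[of m n] primitive_root_power_cofactor[of n m]
      by (auto simp: mult.commute)
    \<comment> \<open>Surjectivity comes from counting: both sides have
      \<open>totient m * totient n\<close> elements.\<close>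
    show "card (?f ` ?P (m * n)) = card (?P m \<times> ?P n)"
      using assms
      by (simp add: card_image[OF inj] card_cartesian_product card_primitive_roots totient_mult_coprime)
  qed
  with inj show ?thesis by (simp add: bij_betw_def)
qed

lemma ramanujan_sum_mult_coprime:
  assumes "coprime m n" "m > 0" "n > 0"
  shows "ramanujan_sum (m * n) (int (i * n + j * m)) = ramanujan_sum m (int i) * ramanujan_sum n (int j)"
proof -
  let ?P = "\<lambda>n. {z. primitive_root_of_unity n z}"
  have "ramanujan_sum m (int i) * ramanujan_sum n (int j) =
      (\<Sum>(u, v)\<in>?P m \<times> ?P n. u ^ i * v ^ j)"
    using assms
    by (simp add: ramanujan_sum_eq_sum_primitive_roots sum_product sum.cartesian_product)
  also have "\<dots> = (\<Sum>w\<in>?P (m * n). (w ^ n) ^ i * (w ^ m) ^ j)"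
    using sum.reindex_bij_betw[OF bij_betw_primitive_roots_coprime[OF assms],
        of "\<lambda>(u, v). u ^ i * v ^ j"] by simp
  also have "\<dots> = (\<Sum>w\<in>?P (m * n). w ^ (i * n + j * m))"
    by (simp add: power_add power_mult power_power_commute[of _ n i] power_power_commute[of _ m j])
  also have "\<dots> = ramanujan_sum (m * n) (int (i * n + j * m))"
    using assms by (simp only: ramanujan_sum_eq_sum_primitive_roots mult_pos_pos)
  finally show ?thesis ..
qed

lemma ramanujan_sum_mod:
  assumes "n > 0"
  shows "ramanujan_sum n (int (k mod n)) = ramanujan_sum n (int k)"
  unfolding ramanujan_sum_eq_sum_primitive_roots[OF assms]
  by (intro sum.cong refl power_mod_root_of_unity) (simp add: primitive_root_of_unity_def)

text \<open>Modulo \<open>m\<close> only \<open>i * n\<close> survives and \<open>n\<close> can be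
  cancelled, so \<open>i\<close> is determined; symmetrically for \<open>j\<close>. This form of the
  Chinese remainder theorem makes both the Ramanujan sum and the power of \<open>z\<close>
  split.\<close>

lemma bij_betw_crt:
  assumes "coprime m n" "m > 0" "n > (0 :: nat)"
  shows "bij_betw (\<lambda>(i, j). (i * n + j * m) mod (m * n)) ({..<m} \<times> {..<n}) {..<m * n}"
proof -
  let ?f = "\<lambda>(i, j). (i * n + j * m) mod (m * n)"
  have inj: "inj_on ?f ({..<m} \<times> {..<n})"
  proof (rule inj_onI, clarsimp)
    fix i j i' j' assume ij: "i < m" "j < n" "i' < m" "j' < n"
      and "(i * n + j * m) mod (m * n) = (i' * n + j' * m) mod (m * n)"
    hence eq: "[i * n + j * m = i' * n + j' * m] (mod m * n)" by (simp add: cong_def)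
    have "[i * n = i' * n] (mod m)" 
      using cong_modulus_mult_nat[OF eq] by (simp add: cong_def)
    hence "[i = i'] (mod m)"
      using assms by (simp add: cong_mult_rcancel_nat coprime_commute)
    moreover have "[j * m = j' * m] (mod n)"
      using cong_modulus_mult_nat[OF eq[unfolded mult.commute[of m n]]] by (simp add: cong_def)
    hence "[j = j'] (mod n)"
      using assms by (simp add: cong_mult_rcancel_nat)
    ultimately show "i = i' \<and> j = j'" using ij by (simp add: cong_def)
  qed
  have "?f ` ({..<m} \<times> {..<n}) = {..<m * n}"
    by (rule card_subset_eq) (use assms in \<open>auto simp: card_image[OF inj] card_cartesian_product\<close>)
  with inj show ?thesis by (simp add: bij_betw_def)
qed

lemma poly_abs_ramanujan_poly_mult_coprime:
  assumes "coprime m n" "m > 0" "n > 0" "z ^ (m * n) = 1"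
  shows "poly (abs_ramanujan_poly (m * n)) z =
           poly (abs_ramanujan_poly m) (z ^ n) * poly (abs_ramanujan_poly n) (z ^ m)"
proof -
  let ?c = "\<lambda>n k. complex_of_real (cmod (ramanujan_sum n (int k)))"
  have mn: "m * n > 0" using assms by simp
  have "poly (abs_ramanujan_poly (m * n)) z =
      (\<Sum>(i, j)\<in>{..<m} \<times> {..<n}. ?c (m * n) ((i * n + j * m) mod (m * n)) * z ^ ((i * n + j * m) mod (m * n)))"
    unfolding poly_abs_ramanujan_poly
    using sum.reindex_bij_betw[OF bij_betw_crt[OF assms(1-3)], of "\<lambda>k. ?c (m * n) k * z ^ k"]
    by (simp add: case_prod_unfold)
  also have "\<dots> = (\<Sum>(i, j)\<in>{..<m} \<times> {..<n}. (?c m i * (z ^ n) ^ i) * (?c n j * (z ^ m) ^ j))"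
  proof (intro sum.cong refl, clarify)
    fix i j
    have "z ^ (i * n + j * m) = (z ^ n) ^ i * (z ^ m) ^ j"
      by (simp add: power_add power_mult power_power_commute[of _ n i] power_power_commute[of _ m j])
    thus "?c (m * n) ((i * n + j * m) mod (m * n)) * z ^ ((i * n + j * m) mod (m * n)) =
        (?c m i * (z ^ n) ^ i) * (?c n j * (z ^ m) ^ j)"
      unfolding ramanujan_sum_mod[OF mn] ramanujan_sum_mult_coprime[OF assms(1-3)]
        power_mod_root_of_unity[OF assms(4)] by (simp add: norm_mult)
  qed
  also have "\<dots> = poly (abs_ramanujan_poly m) (z ^ n) * poly (abs_ramanujan_poly n) (z ^ m)"
    by (simp add: poly_abs_ramanujan_poly sum_product sum.cartesian_product)
  finally show ?thesis .
qed

subsection \<open>Prime powers\<close>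

text \<open>The only divisor of \<open>p ^ Suc a\<close> that does not divide \<open>p ^ a\<close>
  is \<open>p ^ Suc a\<close> itself, so the sum over primitive roots is the difference of two sums
  over all roots of unity.\<close>

lemma ramanujan_sum_prime_power:
  assumes "prime p"
  shows "ramanujan_sum (p ^ Suc a) (int k) =
    (if p ^ Suc a dvd k then of_nat (p ^ Suc a) else 0) - (if p ^ a dvd k then of_nat (p ^ a) else 0)"
proof -
  have p: "p > 0" "p ^ a > 0" "p ^ Suc a > 0" using prime_gt_0_nat[OF assms] by simp_all
  have "{d. d dvd p ^ Suc a} = insert (p ^ Suc a) {d. d dvd p ^ a}"
    using divides_primepow_nat[OF assms, of _ "Suc a"] divides_primepow_nat[OF assms, of _ a]
    by (auto simp: le_Suc_eq)
  moreover have "p ^ Suc a \<notin> {d. d dvd p ^ a}"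
    using prime_gt_1_nat[OF assms] by (auto dest!: dvd_imp_le simp: p)
  ultimately have "(\<Sum>z | z ^ (p ^ Suc a) = 1. z ^ k) =
      ramanujan_sum (p ^ Suc a) (int k) + (\<Sum>z | z ^ (p ^ a) = 1. (z :: complex) ^ k)"
    unfolding sum_roots_of_unity_by_order[OF p(2)] sum_roots_of_unity_by_order[OF p(3)]
      ramanujan_sum_eq_sum_primitive_roots[OF p(3)]
    using p by (simp del: power_Suc)
  thus ?thesis
    unfolding sum_roots_of_unity_power[OF p(2)] sum_roots_of_unity_power[OF p(3)]
    by (simp add: algebra_simps)
qed

text \<open>Only the sign for \<open>p ^ a\<close> exactly dividing \<open>k\<close> has to be flipped, which keeps the absolute value a
  linear combination of indicators of divisibility.\<close>

lemma cmod_ramanujan_sum_prime_power: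
  assumes "prime p"
  shows "complex_of_real (cmod (ramanujan_sum (p ^ Suc a) (int k))) =
    (if p ^ a dvd k then of_nat (p ^ a) else 0) +
    (if p ^ Suc a dvd k then of_nat (p ^ Suc a) - 2 * of_nat (p ^ a) else 0)"
proof -
  consider "p ^ Suc a dvd k" "p ^ a dvd k" | "\<not> p ^ Suc a dvd k" "p ^ a dvd k" 
    | "\<not> p ^ Suc a dvd k" "\<not> p ^ a dvd k"
    by (metis dvd_mult_right power_Suc)
  thus ?thesis
  proof cases
    case 1
    have "cmod (of_nat (p ^ Suc a) - of_nat (p ^ a)) = cmod (of_nat (p ^ Suc a - p ^ a))"
      using prime_gt_0_nat[OF assms] by (subst of_nat_diff) auto
    also have "\<dots> = real (p ^ Suc a - p ^ a)" by (rule norm_of_nat)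
    also have "complex_of_real \<dots> = of_nat (p ^ Suc a) - of_nat (p ^ a)"
      using prime_gt_0_nat[OF assms] by (subst of_nat_diff) auto
    finally have "complex_of_real (cmod (of_nat (p ^ Suc a) - of_nat (p ^ a))) =
        of_nat (p ^ Suc a) - of_nat (p ^ a)" .
    with 1 show ?thesis unfolding ramanujan_sum_prime_power[OF assms] by simp
  qed (simp_all add: ramanujan_sum_prime_power[OF assms] norm_power del: power_Suc)
qed

lemma sum_powers_multiples:
  assumes "d > 0"
  shows "(\<Sum>k<d * e. if d dvd k then (z :: complex) ^ k else 0) = (\<Sum>i<e. (z ^ d) ^ i)"
proof -
  have "(\<Sum>k<d * e. if d dvd k then z ^ k else 0) = (\<Sum>k | k < d * e \<and> d dvd k. z ^ k)"
    by (subst sum.inter_filter[symmetric]) auto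
  also have "\<dots> = (\<Sum>i<e. (z ^ d) ^ i)"
    by (rule sum.reindex_bij_witness[of _ "\<lambda>i. d * i" "\<lambda>k. k div d"])
       (use assms in \<open>auto simp: power_mult\<close>)
  finally show ?thesis .
qed

text \<open>Multiples of \<open>p ^ a\<close> below \<open>p ^ Suc a\<close> contribute a geometric
  sum of length \<open>p\<close>; the only multiple of \<open>p ^ Suc a\<close> in that range is 0,
  which yields the constant.\<close>

lemma poly_abs_ramanujan_poly_prime_power:
  assumes "prime p"
  shows "poly (abs_ramanujan_poly (p ^ Suc a)) z =
    of_nat (p ^ a) * (\<Sum>i<p. (z ^ (p ^ a)) ^ i) + (of_nat (p ^ Suc a) - 2 * of_nat (p ^ a))"
proof -
  have p: "p ^ a > 0" "p ^ Suc a > 0" using prime_gt_0_nat[OF assms] by simp_all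
  \<comment> \<open>The bounds \<open>p ^ a * p\<close> and \<open>p ^ Suc a * 1\<close> are both
    \<open>p ^ Suc a\<close>, written in the shape of \<open>sum_powers_multiples\<close>.\<close>
  have "poly (abs_ramanujan_poly (p ^ Suc a)) z =
     of_nat (p ^ a) * (\<Sum>k<p ^ a * p. if p ^ a dvd k then z ^ k else 0) +
     (of_nat (p ^ Suc a) - 2 * of_nat (p ^ a)) * (\<Sum>k<p ^ Suc a * 1. if p ^ Suc a dvd k then z ^ k else 0)"
    unfolding poly_abs_ramanujan_poly cmod_ramanujan_sum_prime_power[OF assms] sum_distrib_left
      power_Suc2[symmetric] mult_1_right sum.distrib[symmetric]
    by (intro sum.cong refl) (simp add: algebra_simps del: power_Suc of_nat_power)
  thus ?thesis unfolding sum_powers_multiples[OF p(1)] sum_powers_multiples[OF p(2)] by simp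
qed

subsection \<open>Values at roots of unity\<close>

text \<open>Splits off the full power of one prime at a time, so that multiplicativity for coprime
  factors applies in each step.\<close>

lemma prime_power_cofactor_induct [consumes 1, case_names one prime_power]:
  fixes n :: nat
  assumes "n > 0" "P 1"
    "\<And>p a m. prime p \<Longrightarrow> m > 0 \<Longrightarrow> \<not> p dvd m \<Longrightarrow> P m \<Longrightarrow> P (p ^ Suc a * m)"
  shows "P n"
  using assms(1)
proof (induction n rule: less_induct)
  case (less n)
  show ?case
  proof (cases "n = 1")
    case False
    then obtain p where p: "prime p" "p dvd n" using prime_factor_nat by blast
    obtain m where m: "n = p ^ multiplicity p n * m" "\<not> p dvd m"
      using multiplicity_decompose'[of n p] less.prems not_prime_unit[of p] p(1) by blast
    have "multiplicity p n > 0" using p less.prems by (simp add: prime_multiplicity_gt_zero_iff)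
    then obtain a where a: "multiplicity p n = Suc a" using gr0_implies_Suc by blast
    have n: "n = p ^ Suc a * m" using m(1) a by simp
    have "m > 0" using n less.prems by (cases m) auto
    moreover have "m < n"
    proof -
      have "1 < p ^ Suc a" using one_less_power[OF prime_gt_1_nat[OF p(1)]] by blast
      thus ?thesis using n \<open>m > 0\<close> by simp
    qed
    ultimately have "P (p ^ Suc a * m)" using assms(3) p(1) m(2) less.IH by blast
    thus ?thesis using n by simp
  qed (use assms(2) in simp)
qed

lemma prime_factors_prime_power_mult:
  assumes "prime p" "m > (0 :: nat)"
  shows "prime_factors (p ^ Suc a * m) = insert p (prime_factors m)"
proof -
  have "prime_factors (p ^ Suc a) = {p}"
    using assms by (simp add: prime_factors_power prime_prime_factors del: power_Suc)
  moreover have "p ^ Suc a \<noteq> 0" using assms(1) by (auto simp: prime_gt_0_nat)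
  ultimately show ?thesis using assms by (simp add: prime_factors_product del: power_Suc)
qed

lemma coprime_prime_power_left:
  assumes "prime (p :: nat)" "\<not> p dvd m"
  shows "coprime (p ^ a) m"
  using assms by (simp add: prime_imp_coprime coprime_power_left_iff)

lemma poly_abs_ramanujan_poly_1:
  assumes "n > 0"
  shows "poly (abs_ramanujan_poly n) 1 = of_nat (totient n * 2 ^ num_prime_factors n)"
  using assms
proof (induction n rule: prime_power_cofactor_induct)
  case one
  show ?case by (simp add: poly_abs_ramanujan_poly num_prime_factors_def ramanujan_sum_def)
next
  case (prime_power p a m)
  have p: "p ^ Suc a > 0" using prime_gt_0_nat[OF prime_power(1)] by simp
  have co: "coprime (p ^ Suc a) m" using prime_power by (intro coprime_prime_power_left)
  \<comment> \<open>At 1 the geometric sum is \<open>p\<close>, and the total is twice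
    \<open>p ^ Suc a - p ^ a\<close>.\<close>
  have p1: "poly (abs_ramanujan_poly (p ^ Suc a)) 1 = of_nat (2 * totient (p ^ Suc a))"
    unfolding poly_abs_ramanujan_poly_prime_power[OF prime_power(1)] totient_prime_power_Suc[OF prime_power(1)]
    using prime_gt_0_nat[OF prime_power(1)] by (simp add: of_nat_diff algebra_simps)
  have "num_prime_factors (p ^ Suc a * m) = Suc (num_prime_factors m)"
    unfolding num_prime_factors_def prime_factors_prime_power_mult[OF prime_power(1,2)]
    using prime_power(3) by (subst card_insert_disjoint) auto
  thus ?case
    using poly_abs_ramanujan_poly_mult_coprime[OF co p prime_power(2), of 1] prime_power.IH p1
    by (simp add: totient_mult_coprime[OF co] del: power_Suc) simp
qed

lemma poly_abs_ramanujan_poly_primitive_root: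
  assumes "primitive_root_of_unity n \<eta>"
  shows "poly (abs_ramanujan_poly n) \<eta> = of_nat n * (\<Prod>p\<in>prime_factors n. (1 - 2 / of_nat p))"
proof -
  have "n > 0" using assms by (simp add: primitive_root_of_unity_def)
  thus ?thesis using assms
  \<comment> \<open>The root must vary: the hypothesis for \<open>m\<close> is applied to
    \<open>\<eta> ^ (p ^ Suc a)\<close>.\<close>
  proof (induction n arbitrary: \<eta> rule: prime_power_cofactor_induct)
    case one
    show ?case by (simp add: poly_abs_ramanujan_poly ramanujan_sum_def)
  next
    case (prime_power p a m)
    have p0: "p > 0" and p: "p ^ Suc a > 0" using prime_gt_0_nat[OF prime_power(1)] by simp_all
    have co: "coprime (p ^ Suc a) m" using prime_power by (intro coprime_prime_power_left)
    let ?u = "\<eta> ^ m" and ?v = "\<eta> ^ (p ^ Suc a)"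
    have u: "primitive_root_of_unity (p ^ Suc a) ?u" 
      by (rule primitive_root_power_cofactor) (rule prime_power.prems)
    have v: "primitive_root_of_unity m ?v"
      by (rule primitive_root_power_cofactor) (subst mult.commute, rule prime_power.prems)
    \<comment> \<open>The geometric sum runs over powers of a primitive \<open>p\<close>th root and
      vanishes; only the constant, \<open>p ^ Suc a\<close> times \<open>1 - 2 / p\<close>,
      remains.\<close>
    have w: "primitive_root_of_unity p (?u ^ p ^ a)"
      by (rule primitive_root_power_cofactor) (use u in simp)
    hence "?u ^ p ^ a \<noteq> 1"
      using primitive_root_pow_eq_1_iff[OF w, of 1] prime_gt_1_nat[OF prime_power(1)] by auto
    moreover have "(?u ^ p ^ a) ^ p = 1" using w by (simp add: primitive_root_of_unity_def)
    ultimately have "(\<Sum>i<p. (?u ^ p ^ a) ^ i) = 0" by (simp add: sum_powers_root_of_unity)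
    hence pu: "poly (abs_ramanujan_poly (p ^ Suc a)) ?u = of_nat (p ^ Suc a) * (1 - 2 / of_nat p)"
      unfolding poly_abs_ramanujan_poly_prime_power[OF prime_power(1)]
      using p0 by (simp add: field_simps)
    have "\<eta> ^ (p ^ Suc a * m) = 1" using prime_power.prems by (simp add: primitive_root_of_unity_def)
    hence "poly (abs_ramanujan_poly (p ^ Suc a * m)) \<eta> =
        poly (abs_ramanujan_poly (p ^ Suc a)) ?u * poly (abs_ramanujan_poly m) ?v"
      by (rule poly_abs_ramanujan_poly_mult_coprime[OF co p prime_power(2)])
    also have "\<dots> = of_nat (p ^ Suc a * m) * ((1 - 2 / of_nat p) * (\<Prod>p\<in>prime_factors m. (1 - 2 / of_nat p)))"
      unfolding pu prime_power.IH[OF v] of_nat_mult by (simp only: mult_ac)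
    also have "(1 - 2 / of_nat p) * (\<Prod>p\<in>prime_factors m. (1 - 2 / of_nat p)) =
        (\<Prod>p\<in>prime_factors (p ^ Suc a * m). (1 - 2 / complex_of_nat p))"
      unfolding prime_factors_prime_power_mult[OF prime_power(1,2)]
      using prime_power(3) by (subst prod.insert) auto
    finally show ?case .
  qed
qed

section \<open>Reflection symmetry and values at -1\<close>

text \<open>On the unit circle inverse and conjugate agree, so the two sums are complex conjugates
  of each other.\<close>

lemma ramanujan_sum_reflect:
  assumes "k \<le> n" "n > 0"
  shows "cmod (ramanujan_sum n (int (n - k))) = cmod (ramanujan_sum n (int k))"
proof -
  have "z ^ (n - k) = cnj (z ^ k)" if "primitive_root_of_unity n z" for z
  proof -
    have zn: "z ^ n = 1" using that by (simp add: primitive_root_of_unity_def)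
    hence "cmod z ^ n = 1" by (simp flip: norm_power)
    hence "cmod z = 1" using assms power_eq_imp_eq_base[of "cmod z" n 1] by simp
    hence nz: "z ^ k \<noteq> 0" and "z ^ k * cnj (z ^ k) = 1"
      using complex_norm_square[of "z ^ k"] by (auto simp: norm_power)
    moreover have "z ^ k * z ^ (n - k) = 1" using zn assms by (simp flip: power_add)
    ultimately have "z ^ k * z ^ (n - k) = z ^ k * cnj (z ^ k)" by simp
    thus ?thesis using nz by (simp only: mult_left_cancel simp_thms)
  qed
  hence "ramanujan_sum n (int (n - k)) = cnj (ramanujan_sum n (int k))"
    unfolding ramanujan_sum_eq_sum_primitive_roots[OF assms(2)] by (simp add: cnj_sum)
  thus ?thesis by simp
qed

lemma poly_abs_ramanujan_poly_minus_1_odd: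
  assumes "odd n"
  shows "poly (abs_ramanujan_poly n) (-1) = of_nat (totient n)"
proof -
  let ?g = "\<lambda>k. complex_of_real (cmod (ramanujan_sum n (int k))) * (-1) ^ k"
  have n: "n > 0" using assms by (simp add: odd_pos)
  have "(\<Sum>k\<in>{1..<n}. ?g k) = (\<Sum>k\<in>{1..<n}. ?g (n - k))"
    by (rule sum.reindex_bij_witness[of _ "\<lambda>k. n - k" "\<lambda>k. n - k"]) auto
  also have "\<dots> = (\<Sum>k\<in>{1..<n}. - ?g k)"
  proof (intro sum.cong refl)
    fix k assume k: "k \<in> {1..<n}"
    \<comment> \<open>For odd \<open>n\<close>, \<open>k\<close> and \<open>n - k\<close> have
      opposite parity. The terms with positive index thus sum to their own negative, leaving only
      the term \<open>k = 0\<close>.\<close>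
    have "(-1 :: complex) ^ (n - k) = - ((-1) ^ k)"
      using k assms by (cases "even k") auto
    moreover have "cmod (ramanujan_sum n (int (n - k))) = cmod (ramanujan_sum n (int k))"
      using k n by (intro ramanujan_sum_reflect) simp_all
    ultimately show "?g (n - k) = - ?g k" by (simp only: mult_minus_right)
  qed
  also have "\<dots> = - (\<Sum>k\<in>{1..<n}. ?g k)" by (rule sum_negf)
  finally have "(\<Sum>k\<in>{1..<n}. ?g k) = 0" by simp
  moreover have "{..<n} = insert 0 {1..<n}" using n by auto
  moreover have "ramanujan_sum n (int 0) = of_nat (totient n)"
    unfolding ramanujan_sum_eq_sum_primitive_roots[OF n] by (simp add: card_primitive_roots[OF n])
  ultimately show ?thesis by (simp add: poly_abs_ramanujan_poly)
qed

text \<open>Only the factor at 2 sees the sign, through \<open>(-1) ^ (2 ^ a)\<close>. For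
  \<open>a = 0\<close> its geometric sum is \<open>1 + (-1)\<close> and its constant is
  \<open>2 - 2\<close>, so it vanishes; for larger \<open>a\<close> it agrees with its value at
  1.\<close>

lemma poly_abs_ramanujan_poly_minus_1_even:
  assumes "odd m"
  shows "poly (abs_ramanujan_poly (2 ^ Suc a * m)) (-1) =
    (if a = 0 then 0 else of_nat (totient (2 ^ Suc a * m) * 2 ^ num_prime_factors (2 ^ Suc a * m)))"
proof -
  have m: "m > 0" using assms by (simp add: odd_pos)
  have co: "coprime (2 ^ Suc a) m" using assms by (intro coprime_prime_power_left) simp_all
  have split: "poly (abs_ramanujan_poly (2 ^ Suc a * m)) z =
      poly (abs_ramanujan_poly (2 ^ Suc a)) (z ^ m) * poly (abs_ramanujan_poly m) (z ^ 2 ^ Suc a)"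
    if "z ^ (2 ^ Suc a * m) = 1" for z
    by (rule poly_abs_ramanujan_poly_mult_coprime[OF co _ m that]) simp
  have "poly (abs_ramanujan_poly (2 ^ Suc a * m)) (-1) =
      poly (abs_ramanujan_poly (2 ^ Suc a)) (-1) * poly (abs_ramanujan_poly m) 1"
    using split[of "-1"] assms by simp
  moreover have "poly (abs_ramanujan_poly (2 ^ Suc a)) (-1) =
      (if a = 0 then 0 else poly (abs_ramanujan_poly (2 ^ Suc a)) 1)"
    unfolding poly_abs_ramanujan_poly_prime_power[OF two_is_prime_nat]
    by (simp add: numeral_2_eq_2)
  \<comment> \<open>Splitting at 1 as well recombines the two factors into the known value at
    1.\<close>
  ultimately show ?thesis
    using split[of 1] poly_abs_ramanujan_poly_1[of "2 ^ Suc a * m"] m by simp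
qed

subsection \<open>Integrality\<close>

abbreviation complex_poly_of_int :: "int poly \<Rightarrow> complex poly" where
  "complex_poly_of_int \<equiv> map_poly of_int"

lemma complex_poly_of_int_add:
  "complex_poly_of_int (p + q) = complex_poly_of_int p + complex_poly_of_int q"
  by (rule poly_eqI) (simp add: coeff_map_poly)

lemma complex_poly_of_int_mult:
  "complex_poly_of_int (p * q) = complex_poly_of_int p * complex_poly_of_int q"
  by (rule poly_eqI) (simp add: coeff_map_poly coeff_mult)

lemma degree_complex_poly_of_int: "degree (complex_poly_of_int p) = degree p"
  by (rule degree_map_poly) simp

lemma lead_coeff_complex_poly_of_int: "lead_coeff (complex_poly_of_int p) = of_int (lead_coeff p)"
  by (simp add: degree_complex_poly_of_int coeff_map_poly)

lemma complex_poly_of_int_if_coeffs_Ints: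
  assumes "\<And>i. coeff P i \<in> \<int>"
  shows "\<exists>p. P = complex_poly_of_int p"
proof
  show "P = complex_poly_of_int (map_poly (\<lambda>c. \<lfloor>Re c\<rfloor>) P)"
  proof (rule poly_eqI)
    fix i
    from assms[of i] show "coeff P i = coeff (complex_poly_of_int (map_poly (\<lambda>c. \<lfloor>Re c\<rfloor>) P)) i"
      by (auto simp: coeff_map_poly elim!: Ints_cases)
  qed
qed

text \<open>The complex quotient \<open>A\<close> is compared with the integer quotient from
  pseudo-division, which introduces no scaling because \<open>f\<close> is monic. If they differed,
  the remainder would be nonzero of degree at least \<open>degree f\<close>.\<close>

lemma monic_int_poly_exact_quotient:
  assumes "lead_coeff f = 1" "complex_poly_of_int p = complex_poly_of_int f * A"
  shows "\<exists>q. p = f * q \<and> A = complex_poly_of_int q"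
proof -
  obtain q r where qr: "pseudo_divmod p f = (q, r)" by fastforce
  have f: "f \<noteq> 0" using assms(1) by auto
  have p: "p = f * q + r" using pseudo_divmod(1)[OF f qr] assms(1) by simp
  have "complex_poly_of_int r = complex_poly_of_int f * (A - complex_poly_of_int q)"
    using assms(2) unfolding p complex_poly_of_int_add complex_poly_of_int_mult
    by (simp add: algebra_simps)
  moreover have "complex_poly_of_int f \<noteq> 0"
    using lead_coeff_complex_poly_of_int[of f] assms(1) by auto
  moreover have "A - complex_poly_of_int q = 0"
  proof (rule ccontr)
    assume "A - complex_poly_of_int q \<noteq> 0"
    with calculation have "degree r = degree f + degree (A - complex_poly_of_int q)" 
      and "complex_poly_of_int r \<noteq> 0"
      by (metis degree_complex_poly_of_int degree_mult_eq, metis mult_eq_0_iff)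
    thus False using pseudo_divmod(2)[OF f qr] by auto
  qed
  ultimately have "A = complex_poly_of_int q" "complex_poly_of_int r = 0" by simp_all
  moreover from this(2) have "r = 0" by (simp add: map_poly_eq_0_iff)
  ultimately show ?thesis using p by (intro exI[of _ q]) simp
qed

section \<open>Factorisation over roots and integrality of cyclotomic polynomials\<close>

lemma prod_linear_factors_dvd:
  fixes p :: "'a :: idom poly"
  assumes "finite S" "\<And>z. z \<in> S \<Longrightarrow> poly p z = 0"
  shows "(\<Prod>z\<in>S. [:- z, 1:]) dvd p"
  using assms
proof (induction S arbitrary: p rule: finite_induct)
  case (insert a S)
  from insert.prems obtain q where q: "p = [:- a, 1:] * q"
    by (meson dvdE insertI1 poly_eq_0_iff_dvd)
  have "poly q z = 0" if "z \<in> S" for z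
    using insert.prems[of z] insert.hyps that unfolding q by auto
  hence "(\<Prod>z\<in>S. [:- z, 1:]) dvd q" by (rule insert.IH)
  thus ?case unfolding q prod.insert[OF insert.hyps] by (rule mult_dvd_mono[OF dvd_refl])
qed simp

lemma prod_roots_of_unity:
  assumes "n > 0"
  shows "(\<Prod>z | z ^ n = 1. [:- z, 1:]) = monom 1 n - (1 :: complex poly)"
proof -
  let ?p = "monom 1 n - (1 :: complex poly)"
  have deg: "degree ?p = n"
    using assms degree_add_eq_left[of "-1" "monom 1 n :: complex poly"] by (simp add: degree_monom_eq)
  hence "lead_coeff ?p = 1" using assms by simp
  moreover have "poly ?p z = 0 \<longleftrightarrow> z ^ n = 1" for z by (simp add: poly_monom)
  \<comment> \<open>A multiple root would also be a root of the derivative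
    \<open>n * z ^ (n - 1)\<close>, which can vanish only at 0, and 0 is not a root of
    \<open>?p\<close>.\<close>
  moreover have "rsquarefree ?p"
    unfolding rsquarefree_roots
    using assms by (auto simp: pderiv_diff pderiv_monom poly_monom zero_power)
  ultimately show ?thesis using complex_poly_decompose_rsquarefree[of ?p] by simp
qed

lemma prod_cyclotomic_poly:
  assumes "n > 0"
  shows "(\<Prod>d | d dvd n. cyclotomic_poly d) = monom 1 n - 1"
proof -
  have "(\<Prod>z | z ^ n = 1. [:- z, 1:]) = (\<Prod>d | d dvd n. cyclotomic_poly d)"
    unfolding roots_of_unity_eq_Union_primitive[OF assms] cyclotomic_poly_def
  proof (rule prod.UNION_disjoint)
    show "finite {d. d dvd n}" using assms by simp
    show "\<forall>d\<in>{d. d dvd n}. finite {z. primitive_root_of_unity d z}"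
      using finite_primitive_roots by blast
    show "\<forall>d\<in>{d. d dvd n}. \<forall>e\<in>{d. d dvd n}. d \<noteq> e \<longrightarrow>
        {z. primitive_root_of_unity d z} \<inter> {z. primitive_root_of_unity e z} = {}"
      using primitive_root_inj by blast
  qed
  thus ?thesis using prod_roots_of_unity[OF assms] by simp
qed

lemma monic_int_poly_prod:
  assumes "finite S" "\<And>d. d \<in> S \<Longrightarrow> \<exists>f. F d = complex_poly_of_int f \<and> lead_coeff f = 1"
  shows "\<exists>f. (\<Prod>d\<in>S. F d) = complex_poly_of_int f \<and> lead_coeff f = 1"
  using assms
proof (induction S rule: finite_induct)
  case empty
  show ?case by (rule exI[of _ 1]) simp
next
  case (insert d S)
  obtain f g where "F d = complex_poly_of_int f" "lead_coeff f = 1"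
    "(\<Prod>d\<in>S. F d) = complex_poly_of_int g" "lead_coeff g = 1"
    using insert by (metis insert_iff)
  thus ?case
    by (intro exI[of _ "f * g"])
       (simp add: prod.insert[OF insert.hyps] complex_poly_of_int_mult lead_coeff_mult del: coeff_mult_degree_sum)
qed

text \<open>By induction the product over the proper divisors is a monic integer polynomial, and the
  cyclotomic polynomial is the quotient of \<open>monom 1 n - 1\<close> by it.\<close>

lemma cyclotomic_poly_int:
  assumes "n > 0"
  shows "\<exists>f. cyclotomic_poly n = complex_poly_of_int f \<and> lead_coeff f = 1"
  using assms
proof (induction n rule: less_induct)
  case (less n)
  let ?D = "{d. d dvd n} - {n}"
  have "\<exists>f. (\<Prod>d\<in>?D. cyclotomic_poly d) = complex_poly_of_int f \<and> lead_coeff f = 1"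
  proof (rule monic_int_poly_prod)
    fix d assume d: "d \<in> ?D"
    hence "d < n" "d > 0" using less.prems by (auto dest: dvd_imp_le intro: Nat.gr0I)
    thus "\<exists>f. cyclotomic_poly d = complex_poly_of_int f \<and> lead_coeff f = 1" by (rule less.IH)
  qed (use less.prems in simp)
  then obtain f where f: "(\<Prod>d\<in>?D. cyclotomic_poly d) = complex_poly_of_int f" "lead_coeff f = 1"
    by blast
  have "(\<Prod>d | d dvd n. cyclotomic_poly d) = cyclotomic_poly n * (\<Prod>d\<in>?D. cyclotomic_poly d)"
    using less.prems by (intro prod.remove) auto
  also have "\<dots> = complex_poly_of_int f * cyclotomic_poly n" unfolding f(1) by (rule mult.commute)
  finally have "complex_poly_of_int (monom 1 n - 1) = complex_poly_of_int f * cyclotomic_poly n"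
    unfolding prod_cyclotomic_poly[OF less.prems]
    by (rule trans[rotated]) (rule poly_eqI, simp add: coeff_map_poly)
  then obtain q where q: "cyclotomic_poly n = complex_poly_of_int q"
    using monic_int_poly_exact_quotient[OF f(2)] by blast
  have "lead_coeff (cyclotomic_poly n) = 1" by (simp add: cyclotomic_poly_def lead_coeff_prod)
  hence "lead_coeff q = 1" unfolding q lead_coeff_complex_poly_of_int by simp
  with q show ?case by blast
qed

section \<open>Integrality of Ramanujan sums and divisibility\<close>

text \<open>The power sum over all \<open>n\<close>th roots is an integer, and removing the
  Ramanujan sums of the proper divisors, integers by induction, leaves the one for
  \<open>n\<close>.\<close>

lemma ramanujan_sum_Ints:
  assumes "n > 0"
  shows "ramanujan_sum n (int k) \<in> \<int>"
  using assms
proof (induction n rule: less_induct)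
  case (less n)
  have pos: "d > 0" if "d dvd n" for d using that less.prems by (auto intro: Nat.gr0I)
  have "(\<Sum>z | z ^ n = 1. z ^ k) = (\<Sum>d | d dvd n. ramanujan_sum d (int k))"
    unfolding sum_roots_of_unity_by_order[OF less.prems]
    by (intro sum.cong refl) (simp add: ramanujan_sum_eq_sum_primitive_roots pos)
  also have "\<dots> = ramanujan_sum n (int k) + (\<Sum>d\<in>{d. d dvd n} - {n}. ramanujan_sum d (int k))"
    using less.prems by (intro sum.remove) auto
  finally have "ramanujan_sum n (int k) =
      (if n dvd k then of_nat n else 0) - (\<Sum>d\<in>{d. d dvd n} - {n}. ramanujan_sum d (int k))"
    unfolding sum_roots_of_unity_power[OF less.prems] by (simp add: algebra_simps)
  moreover have "(\<Sum>d\<in>{d. d dvd n} - {n}. ramanujan_sum d (int k)) \<in> \<int>"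
  proof (rule Ints_sum)
    fix d assume "d \<in> {d. d dvd n} - {n}"
    thus "ramanujan_sum d (int k) \<in> \<int>"
      using less.prems pos by (intro less.IH) (auto dest: dvd_imp_le)
  qed
  ultimately show ?case by simp
qed

lemma abs_ramanujan_poly_int:
  assumes "n > 0"
  shows "\<exists>p. abs_ramanujan_poly n = complex_poly_of_int p"
proof (rule complex_poly_of_int_if_coeffs_Ints)
  fix i
  have "complex_of_real (cmod (ramanujan_sum n (int k))) \<in> \<int>" for k
  proof -
    from ramanujan_sum_Ints[OF assms] obtain a where "ramanujan_sum n (int k) = of_int a"
      by (rule Ints_cases)
    hence "complex_of_real (cmod (ramanujan_sum n (int k))) = of_int \<bar>a\<bar>"
      by (simp only: norm_of_int of_real_of_int_eq flip: of_int_abs)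
    thus ?thesis by simp
  qed
  thus "coeff (abs_ramanujan_poly n) i \<in> \<int>"
    unfolding abs_ramanujan_poly_def coeff_sum by (intro Ints_sum) simp
qed

lemma cyclotomic_poly_dvd_abs_ramanujan_poly:
  assumes "n > 0" "even n"
  shows "int_poly_dvd (cyclotomic_poly n) (abs_ramanujan_poly n)"
proof -
  obtain f where f: "cyclotomic_poly n = complex_poly_of_int f" "lead_coeff f = 1"
    using cyclotomic_poly_int[OF assms(1)] by blast
  obtain p where p: "abs_ramanujan_poly n = complex_poly_of_int p"
    using abs_ramanujan_poly_int[OF assms(1)] by blast
  \<comment> \<open>The prime 2 contributes the factor \<open>1 - 2 / 2 = 0\<close>, so the value at
    every primitive \<open>n\<close>th root is 0. This gives divisibility over the complex numbers
    first.\<close>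
  have "2 \<in> prime_factors n" using assms by (simp add: prime_factors_dvd)
  hence "(\<Prod>p\<in>prime_factors n. (1 - 2 / complex_of_nat p)) = 0"
    by (intro prod_zero) (auto intro!: bexI[of _ 2])
  hence "cyclotomic_poly n dvd abs_ramanujan_poly n"
    unfolding cyclotomic_poly_def
    by (intro prod_linear_factors_dvd)
       (simp_all add: finite_primitive_roots poly_abs_ramanujan_poly_primitive_root)
  then obtain A where "abs_ramanujan_poly n = cyclotomic_poly n * A" ..
  hence "f dvd p"
    using monic_int_poly_exact_quotient[OF f(2), of p A] f(1) p by auto
  thus ?thesis unfolding int_poly_dvd_def using f(1) p by blast
qed

theorem theorem12:
  shows "(\<forall>n::nat. n \<ge> 1 \<and> odd n \<longrightarrow>
            poly (abs_ramanujan_poly n) (-1) = of_nat (totient n)) \<and>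
         (\<forall>n k::nat. n = 4 * k + 2 \<longrightarrow>
            poly (abs_ramanujan_poly n) (-1) = 0) \<and>
         (\<forall>n k::nat. k \<ge> 1 \<and> n = 4 * k \<longrightarrow>
            poly (abs_ramanujan_poly n) (-1) = of_nat (totient n * 2 ^ num_prime_factors n)) \<and>
         (\<forall>n::nat. n \<ge> 1 \<longrightarrow> (\<forall>\<eta>::complex. primitive_root_of_unity n \<eta> \<longrightarrow>
            poly (abs_ramanujan_poly n) \<eta> =
              of_nat n * (\<Prod>p\<in>prime_factors n. (1 - 2 / of_nat p)))) \<and>
         (\<forall>n::nat. n \<ge> 2 \<and> even n \<longrightarrow>
            int_poly_dvd (cyclotomic_poly n) (abs_ramanujan_poly n))"
proof (intro conjI allI impI)
  fix n :: nat assume "n \<ge> 1 \<and> odd n"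
  thus "poly (abs_ramanujan_poly n) (-1) = of_nat (totient n)"
    by (intro poly_abs_ramanujan_poly_minus_1_odd) simp
next
  fix n k :: nat assume n: "n = 4 * k + 2"
  have "n = 2 ^ Suc 0 * (2 * k + 1)" using n by simp
  thus "poly (abs_ramanujan_poly n) (-1) = 0"
    using poly_abs_ramanujan_poly_minus_1_even[of "2 * k + 1" 0] by simp
next
  fix n k :: nat assume n: "k \<ge> 1 \<and> n = 4 * k"
  obtain m where m: "k = 2 ^ multiplicity 2 k * m" "odd m"
    using multiplicity_decompose'[of k 2] n by auto
  \<comment> \<open>The factor 4 supplies two extra powers of 2, so the parameter \<open>a\<close>
    is a successor and the vanishing branch is excluded.\<close>
  have "n = 2 ^ Suc (Suc (multiplicity 2 k)) * m" using n m(1) by simp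
  thus "poly (abs_ramanujan_poly n) (-1) = of_nat (totient n * 2 ^ num_prime_factors n)"
    using poly_abs_ramanujan_poly_minus_1_even[OF m(2), of "Suc (multiplicity 2 k)"]
    by (simp only: if_False nat.distinct)
next
  fix n :: nat and \<eta> assume "primitive_root_of_unity n \<eta>"
  thus "poly (abs_ramanujan_poly n) \<eta> = of_nat n * (\<Prod>p\<in>prime_factors n. (1 - 2 / of_nat p))"
    by (rule poly_abs_ramanujan_poly_primitive_root)
next
  fix n :: nat assume "n \<ge> 2 \<and> even n"
  thus "int_poly_dvd (cyclotomic_poly n) (abs_ramanujan_poly n)"
    by (intro cyclotomic_poly_dvd_abs_ramanujan_poly) simp_all
qed

end
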